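(* Let $E$ be a finite ground set and $\mathcal{M}$ a matroid on $E$, with matroid basis polytope $P_{\mathcal{M}}$. Then $\mathrm{Lip}(P_{\mathcal{M}})\le\widetilde{\mathrm{Lip}}(P_{\mathcal{M}})\le|E|-1$.
   Context: $P_{\mathcal{M}}\subseteq\mathbb{R}^{E}$ is the convex hull of the indicator vectors $e_I$ of the bases $I$ of $\mathcal{M}$; it lies in $\mathrm{rank}(\mathcal{M})\cdot\Delta_{|E|}$, where $\Delta_k=\{x\in\mathbb{R}^k_{\ge0}:\|x\|_1=1\}$. For a convex set $\mathcal{B}\subseteq\Delta_k$: $\sigma:[n]\times[k]\to\mathbb{R}_{\ge0}$ satisfies $\sigma\sim(\mathcal{B},h)$ if $\sum_p\sigma(p,\cdot)=h$ and $\sigma(p,\cdot)\in\|\sigma(p,\cdot)\|_1\mathcal{B}$ for all $p$; for $h,h'\in\mathcal{B}$ and $\sigma\sim(\mathcal{B},h)$ with $\|\sigma\|_1=1$, $\mathrm{OAT}(\mathcal{B},h,h',\sigma)=\min\|\sigma-\sigma'\|_1$ over $\sigma'\sim(\mathcal{B},h')$ with $\|\sigma'(p,\cdot)\|_1=\|\sigma(p,\cdot)\|_1$ for all $p$, and $\mathrm{Lip}(\mathcal{B})=\max\mathrm{OAT}/\|h-h'\|_1$. This quantity is scale invariant and for a scaled set $c\mathcal{B}$ one sets $\mathrm{Lip}(c\mathcal{B})=\mathrm{Lip}(\mathcal{B})$. For a polytope $\mathcal{B}\subseteq c\Delta_k$ with vertex set $V$, points $h,h'\in\mathcal{B}$,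 and a distribution $\mu$ on $V$ with $\sum_v\mu_vv=h$: $\widetilde{\mathrm{OAT}}(\mathcal{B},h,h',\mu)=\min\sum_{v,v'}\kappa(v,v')\|v-v'\|_1$ over distributions $\mu'$ on $V$ with $\sum_v\mu'_vv=h'$ and couplings $\kappa$ of $(\mu,\mu')$ (nonnegative with marginals $\mu,\mu'$), and $\widetilde{\mathrm{Lip}}(\mathcal{B})=\max\widetilde{\mathrm{OAT}}(\mathcal{B},h,h',\mu)/\|h-h'\|_1$ over all $h,h',\mu$. *)

theory Defs
  imports "HOL-Analysis.Analysis"
begin

section \<open>Matroids and their basis polytopes\<close>

locale matroid =
  fixes E :: "'e set" and indep :: "'e set \<Rightarrow> bool"
  assumes finite_ground: "finite E"
    and indep_ground: "indep X \<Longrightarrow> X \<subseteq> E"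
    and indep_empty: "indep {}"
    and indep_subset: "indep X \<Longrightarrow> Y \<subseteq> X \<Longrightarrow> indep Y"
    and indep_augment:
      "indep X \<Longrightarrow> indep Y \<Longrightarrow> card X < card Y \<Longrightarrow> \<exists>y\<in>Y - X. indep (insert y X)"

definition matroid_bases :: "('e set \<Rightarrow> bool) \<Rightarrow> 'e set set" where
  "matroid_bases indep = {X. indep X \<and> (\<forall>Y. indep Y \<and> X \<subseteq> Y \<longrightarrow> X = Y)}"

definition matroid_rank :: "('e set \<Rightarrow> bool) \<Rightarrow> nat" where
  "matroid_rank indep = Max (card ` {X. indep X})"

definition indicator_vec :: "'e set \<Rightarrow> real ^ 'e" where
  "indicator_vec X = (\<chi> i. indicator X i)"

definition basis_polytope :: "('e::finite set \<Rightarrow> bool) \<Rightarrow> (real ^ 'e) set" where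
  "basis_polytope indep = convex hull (indicator_vec ` matroid_bases indep)"


section \<open>The constants Lip and Lip-tilde\<close>

text \<open>
  All minima and maxima of the theory are taken as infima and suprema in the extended
  nonnegative reals, so that an infeasible minimisation has value \<open>\<infinity>\<close>, an unbounded
  maximisation has value \<open>\<infinity>\<close>, and the maximum over no pair \<open>h \<noteq> h'\<close> (a one-point set)
  has value \<open>0\<close>.
\<close>

definition l1norm :: "real ^ 'k \<Rightarrow> real" where
  "l1norm x = (\<Sum>i\<in>UNIV. \<bar>x $ i\<bar>)"

text \<open>
  A map \<open>\<sigma> : [n] \<times> [k] \<rightarrow> \<real>\<close> is given by its rows \<open>\<sigma> p\<close> for \<open>p < n\<close>; the values
  \<open>\<sigma> p\<close> for \<open>p \<ge> n\<close> are irrelevant.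
\<close>

definition compatible ::
    "nat \<Rightarrow> (nat \<Rightarrow> real ^ 'k) \<Rightarrow> (real ^ 'k) set \<Rightarrow> real ^ 'k \<Rightarrow> bool" where
  "compatible n \<sigma> B h \<longleftrightarrow>
     (\<forall>p<n. \<forall>i. 0 \<le> \<sigma> p $ i) \<and>
     (\<Sum>p<n. \<sigma> p) = h \<and>
     (\<forall>p<n. \<sigma> p \<in> (\<lambda>x. l1norm (\<sigma> p) *\<^sub>R x) ` B)"

text \<open>The source point \<open>h\<close> is determined by \<open>\<sigma>\<close> and therefore not an argument of \<open>OAT\<close>.\<close>

definition OAT ::
    "nat \<Rightarrow> (real ^ 'k) set \<Rightarrow> real ^ 'k \<Rightarrow> (nat \<Rightarrow> real ^ 'k) \<Rightarrow> ennreal" where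
  "OAT n B h' \<sigma> =
     Inf {ennreal (\<Sum>p<n. l1norm (\<sigma> p - \<sigma>' p)) | \<sigma>'.
            compatible n \<sigma>' B h' \<and> (\<forall>p<n. l1norm (\<sigma>' p) = l1norm (\<sigma> p))}"

definition Lip :: "(real ^ 'k) set \<Rightarrow> ennreal" where
  "Lip B =
     Sup {OAT n B h' \<sigma> / ennreal (l1norm (h - h')) | n h h' \<sigma>.
            h \<in> B \<and> h' \<in> B \<and> h \<noteq> h' \<and>
            compatible n \<sigma> B h \<and> (\<Sum>p<n. l1norm (\<sigma> p)) = 1}"

text \<open>
  \<open>Lip\<close> is meant for subsets of the standard simplex. For \<open>A = cB\<close> with \<open>B\<close> in the simplex, the
  constant of \<open>A\<close> is that of \<open>B = A/c\<close>. In the degenerate case \<open>c = 0\<close>, where \<open>A = {0}\<close>, this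
  definition gives \<open>Lip {0} = 0\<close>.
\<close>

definition Lip_scaled :: "real \<Rightarrow> (real ^ 'k) set \<Rightarrow> ennreal" where
  "Lip_scaled c A = Lip ((\<lambda>x. x /\<^sub>R c) ` A)"

definition vertices :: "(real ^ 'k) set \<Rightarrow> (real ^ 'k) set" where
  "vertices B = {v. v extreme_point_of B}"

definition distribution_on :: "'v set \<Rightarrow> ('v \<Rightarrow> real) \<Rightarrow> bool" where
  "distribution_on V \<mu> \<longleftrightarrow> (\<forall>v\<in>V. 0 \<le> \<mu> v) \<and> (\<Sum>v\<in>V. \<mu> v) = 1"

definition coupling_on ::
    "'v set \<Rightarrow> ('v \<Rightarrow> real) \<Rightarrow> ('v \<Rightarrow> real) \<Rightarrow> ('v \<Rightarrow> 'v \<Rightarrow> real) \<Rightarrow> bool" where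
  "coupling_on V \<mu> \<mu>' \<kappa> \<longleftrightarrow>
     (\<forall>v\<in>V. \<forall>v'\<in>V. 0 \<le> \<kappa> v v') \<and>
     (\<forall>v\<in>V. (\<Sum>v'\<in>V. \<kappa> v v') = \<mu> v) \<and>
     (\<forall>v'\<in>V. (\<Sum>v\<in>V. \<kappa> v v') = \<mu>' v')"

definition OAT_tilde ::
    "(real ^ 'k) set \<Rightarrow> real ^ 'k \<Rightarrow> (real ^ 'k \<Rightarrow> real) \<Rightarrow> ennreal" where
  "OAT_tilde B h' \<mu> =
     Inf {ennreal (\<Sum>v\<in>vertices B. \<Sum>v'\<in>vertices B. \<kappa> v v' * l1norm (v - v')) | \<mu>' \<kappa>.
            distribution_on (vertices B) \<mu>' \<and>
            (\<Sum>v\<in>vertices B. \<mu>' v *\<^sub>R v) = h' \<and>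
            coupling_on (vertices B) \<mu> \<mu>' \<kappa>}"

definition Lip_tilde :: "(real ^ 'k) set \<Rightarrow> ennreal" where
  "Lip_tilde B =
     Sup {OAT_tilde B h' \<mu> / ennreal (l1norm (h - h')) | h h' \<mu>.
            h \<in> B \<and> h' \<in> B \<and> h \<noteq> h' \<and>
            distribution_on (vertices B) \<mu> \<and>
            (\<Sum>v\<in>vertices B. \<mu> v *\<^sub>R v) = h}"

end

theory Submission
  imports Defs
begin

text \<open>
  The first inequality holds for every polytope in a scaled simplex: write the rows of \<open>\<sigma>\<close>
  as combinations of vertices and move the mass at each vertex along the coupling.

  For the second, consider transport plans \<open>\<kappa>\<close> between bases with first marginal \<open>\<mu>\<close>. If the
  mean \<open>g\<close> of the second marginal differs from \<open>h'\<close>, then a path of single-element exchanges in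
  bases charged by \<open>\<kappa>\<close> leads from an \<open>s\<close> with \<open>g s > h' s\<close> to a \<open>t\<close> with \<open>g t < h' t\<close>: otherwise the
  set \<open>U\<close> reachable from all such \<open>s\<close> would satisfy \<open>g(- U) = rank(- U) \<ge> h'(- U)\<close>. A simple
  path has at most \<open>|E| - 1\<close> edges, and moving mass \<open>\<epsilon>\<close> along it lowers the defect
  \<open>l1norm (g - h')\<close> by \<open>2 \<epsilon>\<close> at a cost of at most \<open>2 \<epsilon> (|E| - 1)\<close>. By compactness, among
  the plans with cost + \<open>(|E| - 1)\<close> defect \<open>\<le> (|E| - 1) l1norm (h - h')\<close> there is one of minimal
  defect, and this defect is zero.
\<close>

section \<open>The l1 norm\<close>

lemma l1norm_nonneg: "0 \<le> l1norm x"
  by (simp add: l1norm_def sum_nonneg)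

lemma l1norm_eq_0_iff: "l1norm x = 0 \<longleftrightarrow> x = 0"
  by (auto simp: l1norm_def sum_nonneg_eq_0_iff vec_eq_iff)

lemma l1norm_scaleR: "l1norm (c *\<^sub>R x) = \<bar>c\<bar> * l1norm x"
  by (simp add: l1norm_def abs_mult sum_distrib_left)

lemma l1norm_triangle: "l1norm (x + y) \<le> l1norm x + l1norm y"
  by (simp add: l1norm_def sum.distrib [symmetric] sum_mono)

lemma l1norm_sum: "l1norm (sum f A) \<le> (\<Sum>a\<in>A. l1norm (f a))"
proof (induction A rule: infinite_finite_induct)
  case (insert a A)
  then show ?case
    using l1norm_triangle [of "f a" "sum f A"] by simp
qed (simp_all add: l1norm_def)

lemma l1norm_axis: "l1norm (axis i c) = \<bar>c\<bar>"
  by (simp add: l1norm_def axis_def if_distrib [of abs] cong: if_cong)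

lemma l1norm_nonneg_vec: "(\<And>i. 0 \<le> x $ i) \<Longrightarrow> l1norm x = (\<Sum>i\<in>UNIV. x $ i)"
  by (simp add: l1norm_def)

text \<open>On the nonnegative orthant the norm is the coordinate sum, hence additive.\<close>

lemma l1norm_sum_nonneg_vec:
  assumes "\<And>a i. a \<in> A \<Longrightarrow> 0 \<le> f a $ i"
  shows "l1norm (sum f A) = (\<Sum>a\<in>A. l1norm (f a))"
proof -
  have "l1norm (sum f A) = (\<Sum>i\<in>UNIV. \<Sum>a\<in>A. f a $ i)"
    using assms by (subst l1norm_nonneg_vec) (auto intro: sum_nonneg)
  also have "\<dots> = (\<Sum>a\<in>A. \<Sum>i\<in>UNIV. f a $ i)"
    by (rule sum.swap)
  also have "\<dots> = (\<Sum>a\<in>A. l1norm (f a))"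
    using assms by (simp add: l1norm_nonneg_vec)
  finally show ?thesis .
qed

lemma continuous_on_l1norm [continuous_intros]:
  "continuous_on S f \<Longrightarrow> continuous_on S (\<lambda>x. l1norm (f x))"
  unfolding l1norm_def by (intro continuous_intros)

text \<open>Since \<epsilon> exceeds neither the excess at \<open>s\<close> nor the deficit at
  \<open>t\<close>, neither coordinate changes sign, and both absolute values shrink by
  \<epsilon>.\<close>

lemma l1norm_shift_mass:
  fixes x :: "real ^ 'k"
  assumes "0 \<le> \<epsilon>" "\<epsilon> \<le> x $ s" "\<epsilon> \<le> - x $ t" "s \<noteq> t"
  shows "l1norm (x + \<epsilon> *\<^sub>R (axis t 1 - axis s 1)) = l1norm x - 2 * \<epsilon>"
proof -
  have "\<bar>(x + \<epsilon> *\<^sub>R (axis t 1 - axis s 1)) $ i\<bar>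
      = \<bar>x $ i\<bar> - (if i = s then \<epsilon> else 0) - (if i = t then \<epsilon> else 0)" for i
    using assms by (auto simp: axis_def)
  then show ?thesis
    by (simp add: l1norm_def sum_subtractf)
qed


section \<open>Comparison of the two constants\<close>

text \<open>Normalise the weights. If they all vanish, the sum is 0, which is the zero multiple of
  any point of the nonempty hull; this covers rows of mass 0.\<close>

lemma convex_hull_finite_scaleR_cone:
  assumes "finite V" "V \<noteq> {}" "\<And>v. v \<in> V \<Longrightarrow> 0 \<le> a v"
  shows "(\<Sum>v\<in>V. a v *\<^sub>R v) \<in> (\<lambda>x. sum a V *\<^sub>R x) ` (convex hull V)"
proof (cases "sum a V = 0")
  case True
  then have "\<forall>v\<in>V. a v = 0"
    using assms by (simp add: sum_nonneg_eq_0_iff)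
  then show ?thesis
    using assms(2) True by (auto simp: image_constant_conv)
next
  case False
  have "(\<Sum>v\<in>V. a v *\<^sub>R v) = sum a V *\<^sub>R (\<Sum>v\<in>V. (a v / sum a V) *\<^sub>R v)"
    using False by (simp add: scaleR_sum_right)
  moreover have "(\<Sum>v\<in>V. (a v / sum a V) *\<^sub>R v) \<in> convex hull V"
    using assms False
    by (intro convex_sum convex_convex_hull)
      (auto simp: hull_inc sum_divide_distrib [symmetric] intro!: divide_nonneg_nonneg sum_nonneg)
  ultimately show ?thesis
    by blast
qed

text \<open>Row \<open>p\<close> holds a share of the mass at each \<open>v\<close>. Splitting every
  transport \<kappa>(v,v') among the rows in proportion to these shares preserves the row masses and
  turns the total into the mean of the second marginal. The triangle inequality bounds the cost of
  each row. The factor 1/c appears because the points of \<open>V\<close> have norm \<open>c\<close>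
  while the rows are combinations of points of norm 1.\<close>

lemma OAT_le_coupling_cost:
  fixes \<sigma> :: "nat \<Rightarrow> real ^ 'k"
  assumes V: "finite V" "V \<noteq> {}" "\<And>v. v \<in> V \<Longrightarrow> l1norm v = c" "\<And>v i. v \<in> V \<Longrightarrow> 0 \<le> v $ i"
    and c: "0 < c"
    and l: "\<And>p v. p < n \<Longrightarrow> v \<in> V \<Longrightarrow> 0 \<le> l p v"
    and \<sigma>: "\<And>p. p < n \<Longrightarrow> \<sigma> p = (\<Sum>v\<in>V. (l p v / c) *\<^sub>R v)"
    and \<kappa>: "coupling_on V (\<lambda>v. \<Sum>p<n. l p v) \<mu>' \<kappa>"
    and h': "(\<Sum>v\<in>V. \<mu>' v *\<^sub>R v) = c *\<^sub>R h'"
  shows "OAT n ((\<lambda>x. x /\<^sub>R c) ` (convex hull V)) h' \<sigma>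
    \<le> ennreal ((\<Sum>v\<in>V. \<Sum>v'\<in>V. \<kappa> v v' * l1norm (v - v')) / c)"
proof -
  define \<mu> where "\<mu> v = (\<Sum>p<n. l p v)" for v
  \<comment> \<open>If \<open>\<mu> v = 0\<close>, then \<open>w p v = 0\<close>, which is harmless as \<open>l p v\<close> and \<open>\<kappa> v\<close> vanish as well.\<close>
  define w where "w p v = l p v / \<mu> v" for p v
  have \<kappa>0: "0 \<le> \<kappa> v v'" and \<kappa>1: "(\<Sum>v'\<in>V. \<kappa> v v') = \<mu> v" and \<kappa>2: "(\<Sum>v\<in>V. \<kappa> v v') = \<mu>' v'"
    if "v \<in> V" "v' \<in> V" for v v'
    using \<kappa> that by (auto simp: coupling_on_def \<mu>_def)
  have \<mu>0: "0 \<le> \<mu> v" if "v \<in> V" for v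
    using l that by (auto simp: \<mu>_def intro: sum_nonneg)
  have w0: "0 \<le> w p v" if "p < n" "v \<in> V" for p v
    using l \<mu>0 that by (simp add: w_def)
  have w\<mu>: "w p v * \<mu> v = l p v" if "p < n" "v \<in> V" for p v
  proof (cases "\<mu> v = 0")
    case True
    then have "l p v = 0"
      using l that sum_nonneg_0 [of "{..<n}" "\<lambda>p. l p v" p] by (simp add: \<mu>_def)
    then show ?thesis by (simp add: w_def)
  qed (simp add: w_def)
  have w\<kappa>: "(\<Sum>p<n. w p v * \<kappa> v v') = \<kappa> v v'" if "v \<in> V" "v' \<in> V" for v v'
  proof (cases "\<mu> v = 0")
    case True
    then have "\<kappa> v v' = 0"
      using \<kappa>0 \<kappa>1 that V(1) by (metis sum_nonneg_eq_0_iff)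
    then show ?thesis by simp
  next
    case False
    have "(\<Sum>p<n. w p v * \<kappa> v v') = (\<Sum>p<n. l p v) / \<mu> v * \<kappa> v v'"
      by (simp add: w_def sum_distrib_right sum_divide_distrib)
    then show ?thesis
      using False by (simp add: \<mu>_def)
  qed
  \<comment> \<open>\<open>a p v'\<close> is the mass that row \<open>p\<close> holds at
    \<open>v'\<close> after the transport.\<close>
  define a where "a p v' = (\<Sum>v\<in>V. w p v * \<kappa> v v')" for p v'
  define \<sigma>' where "\<sigma>' p = (\<Sum>v'\<in>V. (a p v' / c) *\<^sub>R v')" for p
  have a0: "0 \<le> a p v'" if "p < n" "v' \<in> V" for p v'
    using w0 \<kappa>0 that by (auto simp: a_def intro!: sum_nonneg)
  have asum: "sum (a p) V = sum (l p) V" if "p < n" for p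
  proof -
    have "sum (a p) V = (\<Sum>v\<in>V. \<Sum>v'\<in>V. w p v * \<kappa> v v')"
      unfolding a_def by (rule sum.swap)
    also have "\<dots> = (\<Sum>v\<in>V. w p v * \<mu> v)"
      using \<kappa>1 by (simp add: sum_distrib_left [symmetric])
    finally show ?thesis
      using w\<mu> that by simp
  qed
  have norm_row: "l1norm (\<Sum>v\<in>V. (b v / c) *\<^sub>R v) = sum b V" if "\<And>v. v \<in> V \<Longrightarrow> 0 \<le> b v" for b
    using V(3,4) that c by (subst l1norm_sum_nonneg_vec) (auto simp: l1norm_scaleR)
  have norm\<sigma>': "l1norm (\<sigma>' p) = sum (a p) V" if "p < n" for p
    unfolding \<sigma>'_def using a0 that by (intro norm_row) auto
  have norm\<sigma>: "l1norm (\<sigma> p) = sum (l p) V" if "p < n" for p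
    using l that norm_row[of "l p"] by (simp add: \<sigma>)
  have "compatible n \<sigma>' ((\<lambda>x. x /\<^sub>R c) ` (convex hull V)) h'"
    unfolding compatible_def
  proof (intro conjI allI impI)
    fix p i assume "p < n"
    then show "0 \<le> \<sigma>' p $ i"
      using a0 V(4) c by (auto simp: \<sigma>'_def intro!: sum_nonneg)
  next
    have "(\<Sum>p<n. a p v') = \<mu>' v'" if "v' \<in> V" for v'
    proof -
      have "(\<Sum>p<n. a p v') = (\<Sum>v\<in>V. \<Sum>p<n. w p v * \<kappa> v v')"
        unfolding a_def by (rule sum.swap)
      then show ?thesis
        using w\<kappa> \<kappa>2 that by simp
    qed
    moreover have "(\<Sum>p<n. \<sigma>' p) = (\<Sum>v'\<in>V. ((\<Sum>p<n. a p v') / c) *\<^sub>R v')"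
      unfolding \<sigma>'_def sum_divide_distrib scaleR_sum_left by (rule sum.swap)
    ultimately have "(\<Sum>p<n. \<sigma>' p) = (1 / c) *\<^sub>R (\<Sum>v'\<in>V. \<mu>' v' *\<^sub>R v')"
      by (simp add: scaleR_sum_right)
    then show "(\<Sum>p<n. \<sigma>' p) = h'"
      using h' c by simp
  next
    fix p assume p: "p < n"
    have "(\<Sum>v\<in>V. a p v *\<^sub>R v) \<in> (\<lambda>x. sum (a p) V *\<^sub>R x) ` (convex hull V)"
      using V a0 p by (intro convex_hull_finite_scaleR_cone) auto
    then obtain x where x: "x \<in> convex hull V" "(\<Sum>v\<in>V. a p v *\<^sub>R v) = sum (a p) V *\<^sub>R x"
      by auto
    have "\<sigma>' p = (1 / c) *\<^sub>R (\<Sum>v\<in>V. a p v *\<^sub>R v)"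
      by (simp add: \<sigma>'_def scaleR_sum_right)
    also have "\<dots> = l1norm (\<sigma>' p) *\<^sub>R (x /\<^sub>R c)"
      using x norm\<sigma>' p by (simp add: divide_inverse)
    finally show "\<sigma>' p \<in> (\<lambda>x. l1norm (\<sigma>' p) *\<^sub>R x) ` (\<lambda>x. x /\<^sub>R c) ` (convex hull V)"
      using x(1) by blast
  qed
  moreover have "\<forall>p<n. l1norm (\<sigma>' p) = l1norm (\<sigma> p)"
    using norm\<sigma> norm\<sigma>' asum by simp
  ultimately have "OAT n ((\<lambda>x. x /\<^sub>R c) ` (convex hull V)) h' \<sigma> \<le> ennreal (\<Sum>p<n. l1norm (\<sigma> p - \<sigma>' p))"
    unfolding OAT_def by (intro Inf_lower) blast
  also have "\<dots> \<le> ennreal ((\<Sum>v\<in>V. \<Sum>v'\<in>V. \<kappa> v v' * l1norm (v - v')) / c)"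
  proof (rule ennreal_leI)
    have "l1norm (\<sigma> p - \<sigma>' p) \<le> (\<Sum>v\<in>V. \<Sum>v'\<in>V. w p v * \<kappa> v v' / c * l1norm (v - v'))"
      if p: "p < n" for p
    proof -
      \<comment> \<open>Replacing \<mu>(v) by the row sum of \<kappa> expands the old row over the
        same pairs (v,v') as the new one, so that the two can be subtracted term by term.\<close>
      have "\<sigma> p = (\<Sum>v\<in>V. (w p v * (\<Sum>v'\<in>V. \<kappa> v v') / c) *\<^sub>R v)"
        using p by (simp add: \<sigma> \<kappa>1 w\<mu>)
      also have "\<dots> = (\<Sum>v\<in>V. \<Sum>v'\<in>V. (w p v * \<kappa> v v' / c) *\<^sub>R v)"
        by (simp add: sum_distrib_left sum_divide_distrib scaleR_sum_left)
      finally have 1: "\<sigma> p = (\<Sum>v\<in>V. \<Sum>v'\<in>V. (w p v * \<kappa> v v' / c) *\<^sub>R v)" .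
      have 2: "\<sigma>' p = (\<Sum>v\<in>V. \<Sum>v'\<in>V. (w p v * \<kappa> v v' / c) *\<^sub>R v')"
        unfolding \<sigma>'_def a_def sum_divide_distrib scaleR_sum_left by (rule sum.swap)
      have "l1norm (\<sigma> p - \<sigma>' p)
          = l1norm (\<Sum>v\<in>V. \<Sum>v'\<in>V. (w p v * \<kappa> v v' / c) *\<^sub>R (v - v'))"
        unfolding 1 2 by (simp add: sum_subtractf scaleR_diff_right)
      also have "\<dots> \<le> (\<Sum>v\<in>V. \<Sum>v'\<in>V. l1norm ((w p v * \<kappa> v v' / c) *\<^sub>R (v - v')))"
        by (intro order_trans [OF l1norm_sum] sum_mono l1norm_sum)
      also have "\<dots> = (\<Sum>v\<in>V. \<Sum>v'\<in>V. w p v * \<kappa> v v' / c * l1norm (v - v'))"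
        using w0 \<kappa>0 p c by (intro sum.cong) (auto simp: l1norm_scaleR)
      finally show ?thesis .
    qed
    then have "(\<Sum>p<n. l1norm (\<sigma> p - \<sigma>' p))
        \<le> (\<Sum>p<n. \<Sum>v\<in>V. \<Sum>v'\<in>V. w p v * \<kappa> v v' / c * l1norm (v - v'))"
      by (intro sum_mono) auto
    also have "\<dots> = (\<Sum>v\<in>V. \<Sum>v'\<in>V. \<Sum>p<n. w p v * \<kappa> v v' / c * l1norm (v - v'))"
      by (subst sum.swap, intro sum.cong refl, rule sum.swap)
    also have "\<dots> = (\<Sum>v\<in>V. \<Sum>v'\<in>V. (\<Sum>p<n. w p v * \<kappa> v v') / c * l1norm (v - v'))"
      by (simp add: sum_distrib_right sum_divide_distrib)
    also have "\<dots> = (\<Sum>v\<in>V. \<Sum>v'\<in>V. \<kappa> v v' * l1norm (v - v')) / c"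
      using w\<kappa> by (simp add: sum_divide_distrib)
    finally show "(\<Sum>p<n. l1norm (\<sigma> p - \<sigma>' p))
        \<le> (\<Sum>v\<in>V. \<Sum>v'\<in>V. \<kappa> v v' * l1norm (v - v')) / c" .
  qed
  finally show ?thesis .
qed

text \<open>Decompose every row into vertices and add up the weights of all rows: this gives a
  distribution on the vertices with mean \<open>H\<close>. Any coupling from it yields a competitor
  for \<open>OAT\<close> of the same cost up to the scale \<open>c\<close>.\<close>

lemma Lip_scaled_le_Lip_tilde:
  fixes P :: "(real ^ 'k) set"
  assumes P: "polytope P" and c: "0 \<le> c"
    and P_simplex: "\<And>x. x \<in> P \<Longrightarrow> l1norm x = c" "\<And>x i. x \<in> P \<Longrightarrow> 0 \<le> x $ i"
  shows "Lip_scaled c P \<le> Lip_tilde P"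
  unfolding Lip_scaled_def Lip_def
proof (rule Sup_least, clarify)
  fix n :: nat and h h' :: "real ^ 'k" and \<sigma> :: "nat \<Rightarrow> real ^ 'k" and H H'
  assume H: "H \<in> P" "H' \<in> P" and ne: "H /\<^sub>R c \<noteq> H' /\<^sub>R c"
    and comp: "compatible n \<sigma> ((\<lambda>x. x /\<^sub>R c) ` P) (H /\<^sub>R c)"
    and mass: "(\<Sum>p<n. l1norm (\<sigma> p)) = 1"
  define V where "V = vertices P"
  \<comment> \<open>For \<open>c = 0\<close> the inverse is 0 by convention, so both scaled points
    would be 0 and could not differ.\<close>
  have c: "0 < c" using c ne by (cases "c = 0") auto
  have finV: "finite V"
    using P finite_polyhedron_extreme_points polytope_imp_polyhedron
    by (auto simp: V_def vertices_def)
  have hullV: "P = convex hull V"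
    unfolding V_def vertices_def
    by (intro Krein_Milman_Minkowski polytope_imp_compact polytope_imp_convex P)
  then have VP: "v \<in> P" if "v \<in> V" for v
    using that by (simp add: hull_inc)
  have neV: "V \<noteq> {}" using hullV H by auto
  have "\<forall>p\<in>{..<n}. \<exists>l. (\<forall>v\<in>V. 0 \<le> l v) \<and> sum l V = l1norm (\<sigma> p) \<and>
      \<sigma> p = (\<Sum>v\<in>V. (l v / c) *\<^sub>R v)"
  proof
    fix p assume "p \<in> {..<n}"
    have "\<sigma> p \<in> (\<lambda>y. l1norm (\<sigma> p) *\<^sub>R (y /\<^sub>R c)) ` P"
      using comp \<open>p \<in> {..<n}\<close> unfolding compatible_def image_image by blast
    then obtain y where y: "y \<in> P" "\<sigma> p = l1norm (\<sigma> p) *\<^sub>R (y /\<^sub>R c)"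
      by (rule imageE)
    obtain u where u: "\<forall>v\<in>V. 0 \<le> u v" "sum u V = 1" "(\<Sum>v\<in>V. u v *\<^sub>R v) = y"
      using y(1) unfolding hullV convex_hull_finite [OF finV] by blast
    have "(\<Sum>v\<in>V. (l1norm (\<sigma> p) * u v / c) *\<^sub>R v) = l1norm (\<sigma> p) *\<^sub>R ((\<Sum>v\<in>V. u v *\<^sub>R v) /\<^sub>R c)"
      by (simp add: scaleR_sum_right divide_inverse mult_ac)
    also have "\<dots> = \<sigma> p"
      unfolding u(3) by (rule y(2) [symmetric])
    finally have "\<sigma> p = (\<Sum>v\<in>V. (l1norm (\<sigma> p) * u v / c) *\<^sub>R v)" by (rule sym)
    moreover have "(\<Sum>v\<in>V. l1norm (\<sigma> p) * u v) = l1norm (\<sigma> p)"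
      by (simp add: sum_distrib_left [symmetric] u(2))
    moreover have "\<forall>v\<in>V. 0 \<le> l1norm (\<sigma> p) * u v"
      using u(1) l1norm_nonneg by (blast intro: mult_nonneg_nonneg)
    ultimately show "\<exists>l. (\<forall>v\<in>V. 0 \<le> l v) \<and> sum l V = l1norm (\<sigma> p) \<and>
        \<sigma> p = (\<Sum>v\<in>V. (l v / c) *\<^sub>R v)"
      by (intro exI [of _ "\<lambda>v. l1norm (\<sigma> p) * u v"] conjI)
  qed
  from bchoice [OF this] obtain l where
    "\<forall>p\<in>{..<n}. (\<forall>v\<in>V. 0 \<le> l p v) \<and> sum (l p) V = l1norm (\<sigma> p) \<and>
      \<sigma> p = (\<Sum>v\<in>V. (l p v / c) *\<^sub>R v)"
    by blast
  then have l: "\<And>p v. p < n \<Longrightarrow> v \<in> V \<Longrightarrow> 0 \<le> l p v"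
      "\<And>p. p < n \<Longrightarrow> sum (l p) V = l1norm (\<sigma> p)"
      "\<And>p. p < n \<Longrightarrow> \<sigma> p = (\<Sum>v\<in>V. (l p v / c) *\<^sub>R v)"
    by blast+
  define \<mu> where "\<mu> v = (\<Sum>p<n. l p v)" for v
  have "sum \<mu> V = (\<Sum>p<n. sum (l p) V)"
    unfolding \<mu>_def by (rule sum.swap)
  then have dist: "distribution_on V \<mu>"
    using l mass by (auto simp: distribution_on_def \<mu>_def intro!: sum_nonneg)
  have "(\<Sum>v\<in>V. \<mu> v *\<^sub>R v) = c *\<^sub>R (\<Sum>v\<in>V. \<Sum>p<n. (l p v / c) *\<^sub>R v)"
    using c by (simp add: \<mu>_def scaleR_sum_right scaleR_sum_left)
  also have "\<dots> = c *\<^sub>R (\<Sum>p<n. \<sigma> p)"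
    using l(3) by (subst sum.swap) simp
  also have "\<dots> = H"
    using comp c by (simp add: compatible_def)
  finally have mean: "(\<Sum>v\<in>V. \<mu> v *\<^sub>R v) = H" .
  \<comment> \<open>The rows live at scale 1 and the vertices at scale \<open>c\<close>, so the
    costs differ by the factor \<open>c\<close>. The distance of the two points carries the same
    factor, and it cancels in the quotient.\<close>
  have "OAT n ((\<lambda>x. x /\<^sub>R c) ` P) (H' /\<^sub>R c) \<sigma> * ennreal c \<le> OAT_tilde P H' \<mu>"
    unfolding OAT_tilde_def
  proof (rule Inf_greatest, clarify)
    fix \<mu>' \<kappa>
    assume k: "coupling_on (vertices P) \<mu> \<mu>' \<kappa>" and H': "H' = (\<Sum>v\<in>vertices P. \<mu>' v *\<^sub>R v)"
    let ?C = "\<Sum>v\<in>V. \<Sum>v'\<in>V. \<kappa> v v' * l1norm (v - v')"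
    have "OAT n ((\<lambda>x. x /\<^sub>R c) ` P) (H' /\<^sub>R c) \<sigma> \<le> ennreal (?C / c)"
      unfolding hullV
    proof (rule OAT_le_coupling_cost [OF finV neV _ _ c l(1,3)])
      show "coupling_on V (\<lambda>v. \<Sum>p<n. l p v) \<mu>' \<kappa>"
        using k by (simp add: V_def \<mu>_def [abs_def])
      show "(\<Sum>v\<in>V. \<mu>' v *\<^sub>R v) = c *\<^sub>R (H' /\<^sub>R c)"
        using c H' by (simp add: V_def)
    qed (use VP P_simplex in blast)+
    then have "OAT n ((\<lambda>x. x /\<^sub>R c) ` P) (H' /\<^sub>R c) \<sigma> * ennreal c \<le> ennreal (?C / c) * ennreal c"
      by (rule mult_right_mono) simp
    also have "\<dots> = ennreal ?C"
      using c by (simp add: ennreal_mult'' [symmetric])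
    finally show "OAT n ((\<lambda>x. x /\<^sub>R c) ` P) ((\<Sum>v\<in>vertices P. \<mu>' v *\<^sub>R v) /\<^sub>R c) \<sigma> * ennreal c
      \<le> ennreal (\<Sum>v\<in>vertices P. \<Sum>v'\<in>vertices P. \<kappa> v v' * l1norm (v - v'))"
      by (simp add: H' V_def)
  qed
  moreover have "OAT n ((\<lambda>x. x /\<^sub>R c) ` P) (H' /\<^sub>R c) \<sigma> / ennreal (l1norm (H /\<^sub>R c - H' /\<^sub>R c))
     = OAT n ((\<lambda>x. x /\<^sub>R c) ` P) (H' /\<^sub>R c) \<sigma> * ennreal c / ennreal (l1norm (H - H'))"
  proof -
    have "l1norm (H - H') \<noteq> 0" using ne by (auto simp: l1norm_eq_0_iff)
    then have "0 < l1norm (H - H')" using l1norm_nonneg [of "H - H'"] by simp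
    moreover have "l1norm (H /\<^sub>R c - H' /\<^sub>R c) = l1norm (H - H') / c"
      using c by (simp add: scaleR_diff_right [symmetric] l1norm_scaleR divide_inverse_commute)
    moreover have "inverse (ennreal (r / c)) = ennreal c * inverse (ennreal r)" if "0 < r" for r
      using c that by (simp add: inverse_ennreal ennreal_mult [symmetric] divide_inverse)
    ultimately show ?thesis
      by (simp only: divide_ennreal_def mult.assoc)
  qed
  moreover have "OAT_tilde P H' \<mu> / ennreal (l1norm (H - H')) \<le> Lip_tilde P"
    unfolding Lip_tilde_def
    using H ne dist mean by (intro Sup_upper) (force simp: V_def)
  ultimately show "OAT n ((\<lambda>x. x /\<^sub>R c) ` P) (H' /\<^sub>R c) \<sigma>
      / ennreal (l1norm (H /\<^sub>R c - H' /\<^sub>R c)) \<le> Lip_tilde P"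
    using order_trans [OF divide_right_mono_ennreal] by simp
qed

section \<open>Basis exchange\<close>

lemma indicator_vec_nth: "indicator_vec X $ i = (if i \<in> X then 1 else 0)"
  by (simp add: indicator_vec_def indicator_def)

lemma indicator_vec_inject: "indicator_vec X = indicator_vec Y \<longleftrightarrow> X = Y"
  by (auto simp: vec_eq_iff indicator_vec_nth split: if_splits)

lemma sum_indicator_vec:
  fixes X :: "'e::finite set"
  shows "(\<Sum>i\<in>U. indicator_vec X $ i) = real (card (X \<inter> U))"
proof -
  have "U \<inter> {i. i \<in> X} = X \<inter> U" by auto
  then show ?thesis by (simp add: indicator_vec_nth sum.If_cases)
qed

lemma indicator_vec_exchange:
  assumes "e \<in> B" "f \<notin> B"
  shows "indicator_vec (insert f (B - {e})) = indicator_vec B + (axis f 1 - axis e 1)"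
  using assms by (auto simp: vec_eq_iff indicator_vec_nth axis_def)

section \<open>Vertices of 0/1 polytopes\<close>

text \<open>The hull lies in the unit cube. A proper convex combination of two numbers in [0,1] can
  equal 0 or 1 only if both numbers do, so no 0/1 vector is interior to a segment of the
  hull.\<close>

lemma vertices_convex_hull_indicator_vec:
  "vertices (convex hull (indicator_vec ` F)) = indicator_vec ` (F :: 'e::finite set set)"
proof
  show "vertices (convex hull (indicator_vec ` F)) \<subseteq> indicator_vec ` F"
    using extreme_point_of_convex_hull by (auto simp: vertices_def)
next
  let ?P = "convex hull (indicator_vec ` F) :: (real ^ 'e) set"
  have P01: "?P \<subseteq> cbox 0 1"
    by (rule hull_minimal) (auto simp: mem_box_cart indicator_vec_nth)
  have "indicator_vec X extreme_point_of ?P" if "X \<in> F" for X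
    unfolding extreme_point_of_def
  proof (intro conjI ballI notI)
    show "indicator_vec X \<in> ?P"
      using that by (simp add: hull_inc)
  next
    fix a b assume a: "a \<in> ?P" and b: "b \<in> ?P" and "indicator_vec X \<in> open_segment a b"
    then obtain u where ne: "a \<noteq> b" and u: "0 < u" "u < 1"
      and X: "indicator_vec X = (1 - u) *\<^sub>R a + u *\<^sub>R b"
      by (auto simp: in_segment)
    have "a $ i = b $ i" for i
    proof -
      have ab: "0 \<le> a $ i" "a $ i \<le> 1" "0 \<le> b $ i" "b $ i \<le> 1"
        using a b P01 by (auto simp: mem_box_cart)
      have eq: "(1 - u) * a $ i + u * b $ i = (if i \<in> X then 1 else 0)"
        using X by (simp add: vec_eq_iff indicator_vec_nth)
      show ?thesis
      proof (cases "i \<in> X")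
        case True
        have "(1 - u) * (1 - a $ i) + u * (1 - b $ i) = 0"
          using eq True by (simp add: algebra_simps)
        then show ?thesis
          using u ab by (simp add: add_nonneg_eq_0_iff)
      next
        case False
        then show ?thesis
          using eq u ab by (simp add: add_nonneg_eq_0_iff)
      qed
    qed
    then show False
      using ne by (simp add: vec_eq_iff)
  qed
  then show "indicator_vec ` F \<subseteq> vertices ?P"
    by (auto simp: vertices_def)
qed

section \<open>Consequences of the augmentation axiom\<close>

context matroid
begin

lemma indep_finite: "indep X \<Longrightarrow> finite X"
  using indep_ground finite_ground finite_subset by blast

text \<open>Augment \<open>X\<close> by elements of \<open>Y\<close> until the cardinalities agree,
  by induction on their difference.\<close>

lemma indep_extend:
  "indep X \<Longrightarrow> indep Y \<Longrightarrow> card X \<le> card Y \<Longrightarrow>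
    \<exists>Z. X \<subseteq> Z \<and> Z \<subseteq> X \<union> Y \<and> indep Z \<and> card Z = card Y"
proof (induction "card Y - card X" arbitrary: X)
  case 0
  then show ?case by (intro exI [of _ X]) auto
next
  case (Suc n)
  then have "card X < card Y" by linarith
  with Suc.prems obtain y where y: "y \<in> Y - X" "indep (insert y X)"
    using indep_augment by blast
  then have "card (insert y X) = Suc (card X)"
    using Suc.prems indep_finite by simp
  then have "n = card Y - card (insert y X)" "card (insert y X) \<le> card Y"
    using Suc.hyps(2) by linarith+
  then obtain Z where "insert y X \<subseteq> Z" "Z \<subseteq> insert y X \<union> Y" "indep Z" "card Z = card Y"
    using Suc.hyps(1) y(2) Suc.prems(2) by blast
  then show ?case
    using y by (intro exI [of _ Z]) auto
qed

lemma basis_indep: "B \<in> matroid_bases indep \<Longrightarrow> indep B"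
  by (simp add: matroid_bases_def)

lemma indep_card_le_basis:
  assumes "B \<in> matroid_bases indep" "indep X"
  shows "card X \<le> card B"
proof (rule ccontr)
  assume "\<not> card X \<le> card B"
  then obtain y where "y \<notin> B" "indep (insert y B)"
    using assms indep_augment [of B X] basis_indep by auto
  moreover have "B = insert y B"
    using assms(1) \<open>indep (insert y B)\<close> unfolding matroid_bases_def by blast
  ultimately show False by blast
qed

lemma basis_of_card:
  assumes "B \<in> matroid_bases indep" "indep X" "card X = card B"
  shows "X \<in> matroid_bases indep"
proof -
  have "X = Y" if "indep Y" "X \<subseteq> Y" for Y
    using assms indep_card_le_basis [OF assms(1) that(1)] indep_finite [OF that(1)] that(2)
    by (intro card_seteq) auto
  then show ?thesis
    using assms(2) by (auto simp: matroid_bases_def)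
qed

lemma card_basis:
  assumes "B \<in> matroid_bases indep"
  shows "card B = matroid_rank indep"
proof -
  have "finite {X. indep X}"
    by (rule finite_subset [of _ "Pow E"]) (auto simp: finite_ground dest: indep_ground)
  then show ?thesis
    unfolding matroid_rank_def
    using assms basis_indep indep_card_le_basis by (intro Max_eqI [symmetric]) auto
qed

text \<open>Augment \<open>B \<inter> U\<close> by some \<open>f\<close> from
  \<open>A \<inter> U\<close>, then extend the result within \<open>B\<close> to a set
  \<open>Z\<close> of full size. By cardinality \<open>Z\<close> misses exactly one element
  \<open>e\<close> of \<open>B\<close>, and \<open>e\<close> lies outside \<open>U\<close> because
  \<open>Z\<close> contains \<open>B \<inter> U\<close>.\<close>

lemma basis_exchange_across:
  assumes A: "A \<in> matroid_bases indep" and B: "B \<in> matroid_bases indep"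
    and less: "card (B \<inter> U) < card (A \<inter> U)"
  obtains e f where "e \<in> B - U" "f \<in> U - B" "insert f (B - {e}) \<in> matroid_bases indep"
proof -
  have "indep (B \<inter> U)" "indep (A \<inter> U)"
    using A B basis_indep indep_subset by blast+
  then obtain f where f: "f \<in> A \<inter> U - B \<inter> U" "indep (insert f (B \<inter> U))"
    using indep_augment less by blast
  then obtain Z where Z: "insert f (B \<inter> U) \<subseteq> Z" "Z \<subseteq> insert f (B \<inter> U) \<union> B"
      "indep Z" "card Z = card B"
    using indep_extend [OF f(2) basis_indep [OF B] indep_card_le_basis [OF B f(2)]] by blast
  have fB: "f \<notin> B" using f(1) by blast
  have finB: "finite B" using B basis_indep indep_finite by blast
  have "\<not> B \<subseteq> Z"
    using Z(1,4) f card_subset_eq [OF indep_finite [OF Z(3)], of B] by auto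
  then obtain e where e: "e \<in> B" "e \<notin> Z" by blast
  have "card (insert f (B - {e})) = card Z"
    using fB finB Z(4) card_Suc_Diff1 [OF finB e(1)] by simp
  moreover have "Z \<subseteq> insert f (B - {e})" using Z e by auto
  ultimately have "Z = insert f (B - {e})"
    using finB by (intro card_subset_eq) auto
  then show thesis
    using that [of e f] e f Z basis_of_card [OF B] by auto
qed

end


section \<open>Improving directions along exchange paths\<close>

text \<open>The set reached within \<open>n\<close> steps grows strictly as long as it misses
  \<open>T\<close>, so it would exhaust the type after \<open>CARD('a) - 1\<close> steps.\<close>

lemma relpow_reach_bounded:
  fixes R :: "('a::finite \<times> 'a) set"
  assumes "S \<noteq> {}" "T \<noteq> {}"
    and leave: "\<And>U. S \<subseteq> U \<Longrightarrow> U \<inter> T = {} \<Longrightarrow> \<exists>e\<in>U. \<exists>f. f \<notin> U \<and> (e, f) \<in> R"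
  obtains s t j where "s \<in> S" "t \<in> T" "(s, t) \<in> R ^^ j" "j \<le> CARD('a) - 1"
proof -
  define D where "D n = (\<Union>j\<le>n. (R ^^ j) `` S)" for n
  have SD: "S \<subseteq> D n" for n
    by (auto simp: D_def intro!: bexI [of _ 0])
  have "\<exists>n\<le>CARD('a) - 1. D n \<inter> T \<noteq> {}"
  proof (rule ccontr)
    assume "\<not> ?thesis"
    then have disj: "D n \<inter> T = {}" if "n \<le> CARD('a) - 1" for n
      using that by blast
    \<comment> \<open>The strict inequality, which starts from \<open>S\<close> being nonempty, is
      what gains the last step and gives \<open>CARD('a) - 1\<close> instead of
      \<open>CARD('a)\<close>.\<close>
    have less_card: "n \<le> CARD('a) - 1 \<Longrightarrow> n < card (D n)" for n
    proof (induction n)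
      case 0
      have "D 0 \<noteq> {}" using SD [of 0] assms(1) by blast
      then show ?case by (simp add: card_gt_0_iff)
    next
      case (Suc n)
      then obtain e f where ef: "e \<in> D n" "f \<notin> D n" "(e, f) \<in> R"
        using leave [OF SD [of n] disj [of n]] by auto
      then obtain j s where "j \<le> n" "s \<in> S" "(s, e) \<in> R ^^ j"
        by (auto simp: D_def)
      then have "Suc j \<le> Suc n" "(s, f) \<in> R ^^ Suc j"
        using ef(3) by (auto simp del: relpow.simps intro: relpow_Suc_I)
      then have "f \<in> D (Suc n)"
        using \<open>s \<in> S\<close> unfolding D_def by blast
      moreover have "D n \<subseteq> D (Suc n)"
        unfolding D_def by (intro UN_mono) auto
      ultimately have "card (D n) < card (D (Suc n))"
        using ef by (intro psubset_card_mono) auto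
      moreover have "n < card (D n)"
        using Suc by simp
      ultimately show ?case by linarith
    qed
    have "CARD('a) \<le> card (D (CARD('a) - 1))"
      using less_card [OF order_refl] by linarith
    then have "D (CARD('a) - 1) = UNIV"
      by (intro card_seteq) auto
    then show False
      using disj [of "CARD('a) - 1"] assms(2) by auto
  qed
  then obtain n t where "n \<le> CARD('a) - 1" "t \<in> D n" "t \<in> T" by blast
  moreover from this(2) obtain j s where "j \<le> n" "s \<in> S" "(s, t) \<in> R ^^ j"
    by (auto simp: D_def)
  ultimately show thesis
    using that by (meson order_trans)
qed

section \<open>Transport plans as vectors\<close>

text \<open>A plan is a vector indexed by all pairs (source, target) of subsets, so that compactness
  in a Euclidean space applies; its support in the bases is imposed separately.\<close>

definition plan_row :: "real ^ ('e::finite set \<times> 'e set) \<Rightarrow> 'e set \<Rightarrow> real" where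
  "plan_row \<kappa> A = (\<Sum>B\<in>UNIV. \<kappa> $ (A, B))"

text \<open>For a plan of mass 1 this is the mean of the second marginal.\<close>

definition plan_mean :: "real ^ ('e::finite set \<times> 'e set) \<Rightarrow> real ^ 'e" where
  "plan_mean \<kappa> = (\<Sum>p\<in>UNIV. \<kappa> $ p *\<^sub>R indicator_vec (snd p))"

definition plan_cost :: "real ^ ('e::finite set \<times> 'e set) \<Rightarrow> real" where
  "plan_cost \<kappa> = (\<Sum>p\<in>UNIV. \<kappa> $ p * l1norm (indicator_vec (fst p) - indicator_vec (snd p)))"

lemma linear_plan_row: "linear (\<lambda>\<kappa>. plan_row \<kappa> A)"
  by (rule linearI) (simp_all add: plan_row_def sum.distrib sum_distrib_left)

lemma linear_plan_mean: "linear plan_mean"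
  by (rule linearI) (simp_all add: plan_mean_def sum.distrib scaleR_add_left scaleR_sum_right)

lemma linear_plan_cost: "linear plan_cost"
  by (rule linearI) (simp_all add: plan_cost_def sum.distrib distrib_right sum_distrib_left mult.assoc)

lemma continuous_on_plan [continuous_intros]:
  assumes "continuous_on S f"
  shows "continuous_on S (\<lambda>x. plan_row (f x) A)" "continuous_on S (\<lambda>x. plan_mean (f x))"
    "continuous_on S (\<lambda>x. plan_cost (f x))"
  using assms unfolding plan_row_def plan_mean_def plan_cost_def
  by (intro continuous_intros; simp)+

lemmas linear_plan_simps =
  linear_add [OF linear_plan_row] linear_diff [OF linear_plan_row] linear_scale [OF linear_plan_row]
  linear_add [OF linear_plan_mean] linear_diff [OF linear_plan_mean] linear_scale [OF linear_plan_mean]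
  linear_add [OF linear_plan_cost] linear_diff [OF linear_plan_cost] linear_scale [OF linear_plan_cost]

lemma plan_row_axis: "plan_row (axis (A, B) 1) A' = (if A' = A then 1 else 0)"
  by (simp add: plan_row_def axis_def)

lemma plan_mean_axis: "plan_mean (axis (A, B) 1) = indicator_vec B"
  by (simp add: plan_mean_def axis_def if_distrib [of "\<lambda>c. c *\<^sub>R _"] cong: if_cong)

lemma plan_cost_axis:
  "plan_cost (axis (A, B) 1) = l1norm (indicator_vec A - indicator_vec B)"
  by (simp add: plan_cost_def axis_def if_distrib [of "\<lambda>c. c * _"] cong: if_cong)

lemma sum_plan_row: "(\<Sum>A\<in>UNIV. plan_row \<kappa> A) = (\<Sum>p\<in>UNIV. \<kappa> $ p)"
  unfolding plan_row_def sum.cartesian_product by simp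

lemma inner_indicator_vec: "indicator_vec U \<bullet> x = (\<Sum>i\<in>U. x $ i)"
  by (simp add: inner_vec_def indicator_vec_nth if_distrib [of "\<lambda>c. c * _"] sum.If_cases cong: if_cong)

lemma inner_plan_mean:
  "indicator_vec U \<bullet> plan_mean \<kappa> = (\<Sum>p\<in>UNIV. \<kappa> $ p * real (card (snd p \<inter> U)))"
  by (simp add: plan_mean_def inner_sum_right inner_indicator_vec sum_indicator_vec)

text \<open>
  The directions \<open>d\<close> along which mass can be moved at \<open>\<kappa>\<close> form a convex cone, so the
  exchanges along a path may simply be added up, even when several of them use the same basis.
\<close>

lemma exchange_path_direction:
  fixes \<kappa> :: "real ^ ('e::finite set \<times> 'e set)" and F :: "'e set set"
  defines "R \<equiv> {(e, f). \<exists>A B. 0 < \<kappa> $ (A, B) \<and> e \<in> B \<and> f \<notin> B \<and> insert f (B - {e}) \<in> F}"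
  assumes F: "\<And>A B. 0 < \<kappa> $ (A, B) \<Longrightarrow> B \<in> F"
    and path: "(s, t) \<in> R ^^ j"
  shows "\<exists>d. (\<forall>p. \<kappa> $ p = 0 \<longrightarrow> 0 \<le> d $ p) \<and> (\<forall>A B. B \<notin> F \<longrightarrow> d $ (A, B) = 0) \<and>
    (\<forall>A. plan_row d A = 0) \<and> plan_mean d = axis t 1 - axis s 1 \<and> plan_cost d \<le> 2 * real j"
  using path
proof (induction j arbitrary: t)
  case 0
  then show ?case
    by (intro exI [of _ 0])
      (simp add: linear_0 [OF linear_plan_row] linear_0 [OF linear_plan_mean]
        linear_0 [OF linear_plan_cost])
next
  case (Suc j)
  then obtain r where "(s, r) \<in> R ^^ j" "(r, t) \<in> R" by auto
  with Suc.IH obtain d where d: "\<And>p. \<kappa> $ p = 0 \<Longrightarrow> 0 \<le> d $ p" "\<And>A B. B \<notin> F \<Longrightarrow> d $ (A, B) = 0"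
      "\<And>A. plan_row d A = 0" "plan_mean d = axis r 1 - axis s 1" "plan_cost d \<le> 2 * real j"
    by blast
  obtain A B where AB: "0 < \<kappa> $ (A, B)" "r \<in> B" "t \<notin> B" and B': "insert t (B - {r}) \<in> F"
    using \<open>(r, t) \<in> R\<close> by (auto simp: R_def)
  define B' where "B' = insert t (B - {r})"
  \<comment> \<open>Redirect one unit of the mass going from \<open>A\<close> to \<open>B\<close>
    towards the exchanged basis. Only the entry at (A,B) is lowered, and \<kappa> is positive
    there.\<close>
  define d' where "d' = d + (axis (A, B') 1 - axis (A, B) 1)"
  have ind: "indicator_vec B' = indicator_vec B + (axis t 1 - axis r 1)"
    unfolding B'_def using AB(2,3) by (rule indicator_vec_exchange)
  have "0 \<le> d' $ p" if "\<kappa> $ p = 0" for p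
    using d(1) [OF that] that AB by (auto simp: d'_def axis_def)
  moreover have "d' $ (A', C) = 0" if "C \<notin> F" for A' C
    using d(2) [OF that] that F [OF AB(1)] B' by (auto simp: d'_def axis_def B'_def)
  moreover have "plan_row d' A' = 0" for A'
    by (simp add: d'_def linear_plan_simps d plan_row_axis)
  moreover have "plan_mean d' = axis t 1 - axis s 1"
    by (simp add: d'_def linear_plan_simps d plan_mean_axis ind)
  moreover have "plan_cost d' \<le> 2 * real (Suc j)"
  proof -
    \<comment> \<open>An exchange alters two coordinates by 1 each, so every edge of the path adds
      at most 2 to the cost.\<close>
    have "l1norm (axis r 1 - axis t 1 :: real ^ 'e) \<le> 2"
      using l1norm_triangle [of "axis r 1" "(- 1) *\<^sub>R axis t 1 :: real ^ 'e"]
      by (simp only: l1norm_scaleR l1norm_axis) simp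
    moreover have "indicator_vec A - indicator_vec B'
        = (indicator_vec A - indicator_vec B) + (axis r 1 - axis t 1 :: real ^ 'e)"
      by (simp add: ind)
    then have "l1norm (indicator_vec A - indicator_vec B')
        \<le> l1norm (indicator_vec A - indicator_vec B) + l1norm (axis r 1 - axis t 1 :: real ^ 'e)"
      by (metis l1norm_triangle)
    ultimately show ?thesis
      using d(5) by (simp add: d'_def linear_plan_simps plan_cost_axis)
  qed
  ultimately show ?case by blast
qed

section \<open>Improving a plan that misses its target\<close>

text \<open>The mass that the plan's mean puts on \<open>U\<close> is the average of the cardinality
  of \<open>B \<inter> U\<close> over charged \<open>B\<close>, so some charged \<open>B\<close> is
  at most average. Since \<open>x\<close> in the hull exceeds this average, some basis
  \<open>C\<close> does too. Exchange across \<open>U\<close> then applies to \<open>B\<close> and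
  \<open>C\<close>.\<close>

lemma exchange_leaving:
  assumes "matroid (UNIV :: 'e::finite set) indep"
    and \<kappa>: "\<And>p. 0 \<le> \<kappa> $ p" "\<And>A B. B \<notin> matroid_bases indep \<Longrightarrow> \<kappa> $ (A, B) = 0"
      "(\<Sum>p\<in>UNIV. \<kappa> $ p) = 1"
    and x: "x \<in> basis_polytope indep"
    and less: "(\<Sum>i\<in>U. plan_mean \<kappa> $ i) < (\<Sum>i\<in>U. x $ i)"
  shows "\<exists>A B. \<exists>e\<in>B - U. \<exists>f\<in>U - B. 0 < \<kappa> $ (A, B) \<and> insert f (B - {e}) \<in> matroid_bases indep"
proof -
  interpret matroid UNIV indep by fact
  define q where "q = indicator_vec U \<bullet> plan_mean \<kappa>"
  have "\<exists>C\<in>matroid_bases indep. q < real (card (C \<inter> U))"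
  proof (rule ccontr)
    assume "\<not> ?thesis"
    then have "basis_polytope indep \<subseteq> {y. indicator_vec U \<bullet> y \<le> q}"
      unfolding basis_polytope_def
      by (intro hull_minimal convex_halfspace_le)
        (auto simp: inner_indicator_vec sum_indicator_vec not_less)
    then show False
      using x less by (auto simp: q_def inner_indicator_vec)
  qed
  then obtain C where C: "C \<in> matroid_bases indep" "q < real (card (C \<inter> U))" by blast
  have "\<exists>p. 0 < \<kappa> $ p \<and> card (snd p \<inter> U) < card (C \<inter> U)"
  proof (rule ccontr)
    assume "\<not> ?thesis"
    then have "\<kappa> $ p * real (card (C \<inter> U)) \<le> \<kappa> $ p * real (card (snd p \<inter> U))" for p
    proof (cases "\<kappa> $ p = 0")
      case False
      then have "0 < \<kappa> $ p" using \<kappa>(1) [of p] by simp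
      then have "card (C \<inter> U) \<le> card (snd p \<inter> U)"
        using \<open>\<not> (\<exists>p. 0 < \<kappa> $ p \<and> card (snd p \<inter> U) < card (C \<inter> U))\<close> not_less by blast
      then show ?thesis
        using \<kappa>(1) by (intro mult_left_mono) auto
    qed simp
    then have "(\<Sum>p\<in>UNIV. \<kappa> $ p * real (card (C \<inter> U))) \<le> q"
      unfolding q_def inner_plan_mean by (intro sum_mono)
    then show False
      using C(2) \<kappa>(3) by (simp add: sum_distrib_right [symmetric])
  qed
  then obtain A B where AB: "0 < \<kappa> $ (A, B)" "card (B \<inter> U) < card (C \<inter> U)"
    by auto
  then have "B \<in> matroid_bases indep"
    using \<kappa>(2) by (metis less_irrefl)
  from basis_exchange_across [OF C(1) this AB(2)] AB(1) show ?thesis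
    by metis
qed

lemma sum_basis_polytope:
  assumes "matroid (UNIV :: 'e::finite set) indep" "x \<in> basis_polytope indep"
  shows "(\<Sum>i\<in>UNIV. x $ i) = real (matroid_rank indep)" "\<And>i. 0 \<le> x $ i"
proof -
  interpret matroid UNIV indep by fact
  have "basis_polytope indep \<subseteq> {y. indicator_vec UNIV \<bullet> y = real (matroid_rank indep)}"
    unfolding basis_polytope_def
    by (intro hull_minimal convex_hyperplane)
      (auto simp: inner_indicator_vec sum_indicator_vec card_basis)
  then show "(\<Sum>i\<in>UNIV. x $ i) = real (matroid_rank indep)"
    using assms(2) by (auto simp: inner_indicator_vec)
  have "basis_polytope indep \<subseteq> cbox 0 1"
    unfolding basis_polytope_def
    by (intro hull_minimal) (auto simp: mem_box_cart indicator_vec_nth)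
  then show "0 \<le> x $ i" for i
    using assms(2) by (auto simp: mem_box_cart)
qed

text \<open>Moving \<epsilon> along the path costs at most 2\<epsilon>(|E| - 1) and lowers the
  defect by 2\<epsilon>. The weight |E| - 1 on the defect is chosen so that the two effects
  balance.\<close>

lemma improve_plan:
  fixes \<kappa> :: "real ^ ('e::finite set \<times> 'e set)"
  assumes M: "matroid (UNIV :: 'e set) indep"
    and \<kappa>: "\<And>p. 0 \<le> \<kappa> $ p" "\<And>A B. B \<notin> matroid_bases indep \<Longrightarrow> \<kappa> $ (A, B) = 0"
      "(\<Sum>p\<in>UNIV. \<kappa> $ p) = 1"
    and h': "h' \<in> basis_polytope indep" and ne: "plan_mean \<kappa> \<noteq> h'"
  obtains \<kappa>' where "\<And>p. 0 \<le> \<kappa>' $ p" "\<And>A B. B \<notin> matroid_bases indep \<Longrightarrow> \<kappa>' $ (A, B) = 0"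
    "\<And>A. plan_row \<kappa>' A = plan_row \<kappa> A"
    "l1norm (plan_mean \<kappa>' - h') < l1norm (plan_mean \<kappa> - h')"
    "plan_cost \<kappa>' + (real CARD('e) - 1) * l1norm (plan_mean \<kappa>' - h')
      \<le> plan_cost \<kappa> + (real CARD('e) - 1) * l1norm (plan_mean \<kappa> - h')"
proof -
  interpret matroid UNIV indep by fact
  let ?N = "real CARD('e) - 1"
  define x where "x = plan_mean \<kappa> - h'"
  define S T where "S = {i. 0 < x $ i}" and "T = {i. x $ i < 0}"
  define R where "R = {(e, f). \<exists>A B. 0 < \<kappa> $ (A, B) \<and> e \<in> B \<and> f \<notin> B \<and>
    insert f (B - {e}) \<in> matroid_bases indep}"
  have pos: "B \<in> matroid_bases indep" if "0 < \<kappa> $ (A, B)" for A B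
    using \<kappa>(2) that by (metis less_irrefl)
  have "\<kappa> $ p * real (card (snd p)) = \<kappa> $ p * real (matroid_rank indep)" for p
    using \<kappa>(2) card_basis by (cases p) (metis mult_zero_left snd_conv)
  then have "indicator_vec UNIV \<bullet> plan_mean \<kappa> = real (matroid_rank indep)"
    using \<kappa>(3) by (simp only: inner_plan_mean Int_UNIV_right sum_distrib_right [symmetric]
        mult_1_left)
  \<comment> \<open>Both points have coordinate sum equal to the rank. Excess and deficit therefore
    balance, and a nonzero \<open>x\<close> takes both signs.\<close>
  then have sumx: "(\<Sum>i\<in>UNIV. x $ i) = 0"
    using sum_basis_polytope(1) [OF M h'] by (simp add: x_def inner_indicator_vec sum_subtractf)
  have "x \<noteq> 0" using ne by (simp add: x_def)
  then obtain i where i: "x $ i \<noteq> 0" by (auto simp: vec_eq_iff)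
  have "S \<noteq> {}"
  proof
    assume "S = {}"
    then have "\<forall>i. 0 \<le> - x $ i" by (auto simp: S_def not_less)
    moreover have "(\<Sum>i\<in>UNIV. - x $ i) = 0" using sumx by (simp add: sum_negf)
    ultimately show False
      using i sum_nonneg_0 [of UNIV "\<lambda>i. - x $ i" i] by simp
  qed
  have "T \<noteq> {}"
  proof
    assume "T = {}"
    then have "\<forall>i. 0 \<le> x $ i" by (auto simp: T_def not_less)
    then show False
      using i sumx sum_nonneg_0 [of UNIV "\<lambda>i. x $ i" i] by simp
  qed
  have "\<exists>e\<in>U. \<exists>f. f \<notin> U \<and> (e, f) \<in> R" if U: "S \<subseteq> U" "U \<inter> T = {}" for U
  proof -
    obtain t where "t \<in> T" using \<open>T \<noteq> {}\<close> by blast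
    \<comment> \<open>Off \<open>U\<close> no coordinate of \<open>x\<close> is positive, and at
      \<open>t\<close> it is negative. Exchange across the complement of \<open>U\<close> thus
      provides an edge leaving \<open>U\<close>.\<close>
    then have "(\<Sum>i\<in>- U. plan_mean \<kappa> $ i) < (\<Sum>i\<in>- U. h' $ i)"
      using U by (intro sum_strict_mono_ex1) (force simp: S_def T_def x_def)+
    from exchange_leaving [OF M \<kappa> h' this] show ?thesis
      unfolding R_def by blast
  qed
  then obtain s t j where st: "s \<in> S" "t \<in> T" "(s, t) \<in> R ^^ j" "j \<le> CARD('e) - 1"
    using relpow_reach_bounded [OF \<open>S \<noteq> {}\<close> \<open>T \<noteq> {}\<close>, of R] by metis
  obtain d where d: "\<And>p. \<kappa> $ p = 0 \<Longrightarrow> 0 \<le> d $ p"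
      "\<And>A B. B \<notin> matroid_bases indep \<Longrightarrow> d $ (A, B) = 0"
      "\<And>A. plan_row d A = 0" "plan_mean d = axis t 1 - axis s 1" "plan_cost d \<le> 2 * real j"
    using exchange_path_direction [of \<kappa> "matroid_bases indep" s t j] pos st(3) unfolding R_def
    by blast
  \<comment> \<open>Where \<kappa> vanishes the direction is nonnegative; elsewhere \<kappa> is
    positive and continuity suffices. As there are finitely many entries, one small \<epsilon>
    serves them all.\<close>
  have "\<forall>\<^sub>F \<epsilon> in at_right 0. 0 \<le> \<kappa> $ p + \<epsilon> * d $ p" for p
  proof (cases "\<kappa> $ p = 0")
    case True
    then show ?thesis
      using d(1) by (auto simp: eventually_at_right_field intro!: exI [of _ 1])
  next
    case False
    have "((\<lambda>\<epsilon>. \<kappa> $ p + \<epsilon> * d $ p) \<longlongrightarrow> \<kappa> $ p + 0 * d $ p) (at_right 0)"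
      by (intro tendsto_intros)
    moreover have "0 < \<kappa> $ p + 0 * d $ p"
      using False \<kappa>(1) [of p] by simp
    ultimately have "\<forall>\<^sub>F \<epsilon> in at_right 0. 0 < \<kappa> $ p + \<epsilon> * d $ p"
      by (rule order_tendstoD(1))
    then show ?thesis
      by (rule eventually_mono) simp
  qed
  then have "\<forall>\<^sub>F \<epsilon> in at_right 0. \<forall>p. 0 \<le> \<kappa> $ p + \<epsilon> * d $ p"
    by (rule eventually_all_finite)
  moreover have "\<forall>\<^sub>F \<epsilon> in at_right 0. \<epsilon> < min (x $ s) (- x $ t)"
    using st unfolding eventually_at_right_field
    by (intro exI [of _ "min (x $ s) (- x $ t)"]) (auto simp: S_def T_def)
  moreover have "\<forall>\<^sub>F \<epsilon> :: real in at_right 0. 0 < \<epsilon>"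
    by (auto simp: eventually_at_right_field intro!: exI [of _ 1])
  ultimately have "\<forall>\<^sub>F \<epsilon> in at_right 0. (\<forall>p. 0 \<le> \<kappa> $ p + \<epsilon> * d $ p) \<and>
      \<epsilon> < min (x $ s) (- x $ t) \<and> 0 < \<epsilon>"
    by (intro eventually_conj)
  then obtain \<epsilon> where \<epsilon>: "\<And>p. 0 \<le> \<kappa> $ p + \<epsilon> * d $ p" "\<epsilon> < x $ s" "\<epsilon> < - x $ t" "0 < \<epsilon>"
    using eventually_happens' [OF trivial_limit_at_right_real] by fastforce
  define \<kappa>' where "\<kappa>' = \<kappa> + \<epsilon> *\<^sub>R d"
  have "plan_mean \<kappa>' - h' = x + \<epsilon> *\<^sub>R (axis t 1 - axis s 1)"
    by (simp add: \<kappa>'_def linear_plan_simps d x_def)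
  moreover have "s \<noteq> t"
    using st by (auto simp: S_def T_def)
  ultimately have norm: "l1norm (plan_mean \<kappa>' - h') = l1norm (plan_mean \<kappa> - h') - 2 * \<epsilon>"
    using l1norm_shift_mass [of \<epsilon> x s t] \<epsilon>(2-4) by (simp flip: x_def)
  have "Suc j \<le> CARD('e)"
    using st(4) zero_less_card_finite [where 'a = 'e] by linarith
  then have "real (Suc j) \<le> real CARD('e)"
    by (simp only: of_nat_le_iff)
  then have "plan_cost d \<le> 2 * ?N"
    using d(5) by simp
  then have "\<epsilon> * plan_cost d \<le> \<epsilon> * (2 * ?N)"
    using \<epsilon>(4) by (intro mult_left_mono) auto
  then have "plan_cost \<kappa>' \<le> plan_cost \<kappa> + 2 * \<epsilon> * ?N"
    by (simp add: \<kappa>'_def linear_plan_simps mult_ac)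
  then have "plan_cost \<kappa>' + ?N * l1norm (plan_mean \<kappa>' - h')
      \<le> plan_cost \<kappa> + ?N * l1norm (plan_mean \<kappa> - h')"
    unfolding norm by (simp add: algebra_simps)
  moreover have "plan_row \<kappa>' A = plan_row \<kappa> A" for A
    by (simp add: \<kappa>'_def linear_plan_simps d)
  ultimately show thesis
    using \<epsilon>(1,4) d(2) \<kappa>(2) norm by (intro that [of \<kappa>']) (simp_all add: \<kappa>'_def)
qed

section \<open>A cheap plan with prescribed mean, by compactness\<close>

lemma transport_plan_exists:
  fixes m :: "'e::finite set \<Rightarrow> real"
  assumes M: "matroid (UNIV :: 'e set) indep"
    and m: "\<And>A. 0 \<le> m A" "\<And>A. A \<notin> matroid_bases indep \<Longrightarrow> m A = 0" "(\<Sum>A\<in>UNIV. m A) = 1"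
    and h: "h = (\<Sum>A\<in>UNIV. m A *\<^sub>R indicator_vec A)" and h': "h' \<in> basis_polytope indep"
  obtains \<kappa> where "\<And>p. 0 \<le> \<kappa> $ p" "\<And>A B. B \<notin> matroid_bases indep \<Longrightarrow> \<kappa> $ (A, B) = 0"
    "\<And>A. plan_row \<kappa> A = m A" "plan_mean \<kappa> = h'"
    "plan_cost \<kappa> \<le> (real CARD('e) - 1) * l1norm (h - h')"
proof -
  let ?N = "real CARD('e) - 1"
  \<comment> \<open>The last condition is a budget: it survives every improvement, and at defect
    zero it is the desired cost bound.\<close>
  define K where "K = {\<kappa>. (\<forall>p. 0 \<le> \<kappa> $ p) \<and> (\<forall>A. \<forall>B\<in>- matroid_bases indep. \<kappa> $ (A, B) = 0) \<and>
    (\<forall>A. plan_row \<kappa> A = m A) \<and> plan_cost \<kappa> + ?N * l1norm (plan_mean \<kappa> - h') \<le> ?N * l1norm (h - h')}"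
  have "K \<subseteq> cbox 0 1"
  \<comment> \<open>Each entry is at most its row sum \<open>m A\<close>, which is at most the total
    mass 1.\<close>
  proof
    fix \<kappa> assume K: "\<kappa> \<in> K"
    have "\<kappa> $ (A, B) \<le> 1" for A B
    proof -
      have "\<kappa> $ (A, B) \<le> plan_row \<kappa> A"
        unfolding plan_row_def using K by (intro member_le_sum) (auto simp: K_def)
      also have "\<dots> = m A" using K by (simp add: K_def)
      also have "\<dots> \<le> sum m UNIV" using m(1) by (intro member_le_sum) auto
      finally show ?thesis using m(3) by simp
    qed
    then show "\<kappa> \<in> cbox 0 1"
      using K by (auto simp: K_def mem_box_cart)
  qed
  then have "bounded K"
    using bounded_cbox bounded_subset by blast
  moreover have "closed K"
    unfolding K_def Ball_def
    by (intro closed_Collect_conj closed_Collect_all closed_Collect_imp closed_Collect_le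
        closed_Collect_eq continuous_intros) auto
  ultimately have "compact K"
    by (simp add: compact_eq_bounded_closed)
  \<comment> \<open>The plan that leaves all mass in place has cost 0 and meets the budget with
    equality.\<close>
  define \<kappa>0 :: "real ^ ('e set \<times> 'e set)"
    where "\<kappa>0 = (\<chi> p. if snd p = fst p then m (fst p) else 0)"
  have sum_diag: "(\<Sum>p\<in>UNIV. if snd p = fst p then f p else 0) = (\<Sum>A\<in>UNIV. f (A, A))"
    for f :: "'e set \<times> 'e set \<Rightarrow> 'b::comm_monoid_add"
    unfolding UNIV_Times_UNIV [symmetric] sum.cartesian_product' by simp
  have "plan_mean \<kappa>0 = h"
    by (simp add: plan_mean_def \<kappa>0_def h if_distrib [of "\<lambda>c. c *\<^sub>R _"] sum_diag cong: if_cong)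
  moreover have "plan_cost \<kappa>0 = 0"
    by (auto simp: plan_cost_def \<kappa>0_def l1norm_def intro!: sum.neutral)
  moreover have "plan_row \<kappa>0 A = m A" for A
    by (simp add: plan_row_def \<kappa>0_def)
  ultimately have "\<kappa>0 \<in> K"
    using m by (auto simp: K_def \<kappa>0_def)
  then have "K \<noteq> {}" by blast
  moreover have "continuous_on K (\<lambda>\<kappa>. l1norm (plan_mean \<kappa> - h'))"
    by (intro continuous_intros)
  ultimately obtain \<kappa> where \<kappa>: "\<kappa> \<in> K"
      and min: "\<And>\<kappa>'. \<kappa>' \<in> K \<Longrightarrow> l1norm (plan_mean \<kappa> - h') \<le> l1norm (plan_mean \<kappa>' - h')"
    using continuous_attains_inf [OF \<open>compact K\<close>] by blast
  have \<kappa>': "\<And>p. 0 \<le> \<kappa> $ p" "\<And>A B. B \<notin> matroid_bases indep \<Longrightarrow> \<kappa> $ (A, B) = 0"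
      "\<And>A. plan_row \<kappa> A = m A"
    and cost: "plan_cost \<kappa> + ?N * l1norm (plan_mean \<kappa> - h') \<le> ?N * l1norm (h - h')"
    using \<kappa> by (auto simp: K_def)
  have mass: "(\<Sum>p\<in>UNIV. \<kappa> $ p) = 1"
    using m(3) \<kappa>'(3) by (simp add: sum_plan_row [symmetric])
  have mean: "plan_mean \<kappa> = h'"
  proof (rule ccontr)
    assume "plan_mean \<kappa> \<noteq> h'"
    from improve_plan [OF M \<kappa>'(1,2) mass h' this] obtain \<kappa>1 where
      \<kappa>1: "\<And>p. 0 \<le> \<kappa>1 $ p" "\<And>A B. B \<notin> matroid_bases indep \<Longrightarrow> \<kappa>1 $ (A, B) = 0"
        "\<And>A. plan_row \<kappa>1 A = plan_row \<kappa> A"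
        "l1norm (plan_mean \<kappa>1 - h') < l1norm (plan_mean \<kappa> - h')"
        "plan_cost \<kappa>1 + ?N * l1norm (plan_mean \<kappa>1 - h')
          \<le> plan_cost \<kappa> + ?N * l1norm (plan_mean \<kappa> - h')"
      by metis
    then have "\<kappa>1 \<in> K"
      using \<kappa>'(3) cost by (auto simp: K_def)
    then show False
      using min \<kappa>1(4) by fastforce
  qed
  then have "plan_cost \<kappa> \<le> ?N * l1norm (h - h')"
    using cost by (simp add: l1norm_def)
  with \<kappa>' mean show thesis
    using that by blast
qed

section \<open>From plans on sets to couplings of vertices\<close>

text \<open>The vertices are the indicator vectors of the bases, so distributions and couplings
  carry over along this injection.\<close>

lemma Lip_tilde_basis_polytope_le:
  fixes indep :: "'e::finite set \<Rightarrow> bool"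
  assumes M: "matroid (UNIV :: 'e set) indep"
  shows "Lip_tilde (basis_polytope indep) \<le> ennreal (real CARD('e) - 1)"
  unfolding Lip_tilde_def
proof (rule Sup_least, clarify)
  fix h' :: "real ^ 'e" and \<mu>
  let ?F = "matroid_bases indep"
  let ?V = "vertices (basis_polytope indep)"
  let ?N = "real CARD('e) - 1"
  define h where "h = (\<Sum>v\<in>?V. \<mu> v *\<^sub>R v)"
  assume h': "h' \<in> basis_polytope indep" and \<mu>: "distribution_on ?V \<mu>"
    and "(\<Sum>v\<in>?V. \<mu> v *\<^sub>R v) \<noteq> h'"
  then have l: "0 < l1norm (h - h')"
    using l1norm_nonneg [of "h - h'"] l1norm_eq_0_iff [of "h - h'"] by (simp add: h_def less_le)
  have V: "?V = indicator_vec ` ?F"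
    by (simp add: basis_polytope_def vertices_convex_hull_indicator_vec)
  have inj: "inj_on indicator_vec ?F"
    by (simp add: inj_on_def indicator_vec_inject)
  have sumV: "sum g ?V = (\<Sum>A\<in>?F. g (indicator_vec A))" for g :: "real ^ 'e \<Rightarrow> 'b::comm_monoid_add"
    unfolding V by (simp add: sum.reindex [OF inj])
  have sumF: "(\<Sum>A\<in>?F. g A) = (\<Sum>A\<in>UNIV. g A)" if "\<And>A. A \<notin> ?F \<Longrightarrow> g A = 0"
    for g :: "'e set \<Rightarrow> 'b::comm_monoid_add"
    using that by (intro sum.mono_neutral_left) auto
  \<comment> \<open>\<mu> is arbitrary off the vertices, hence the extension by 0.\<close>
  define m where "m A = (if A \<in> ?F then \<mu> (indicator_vec A) else 0)" for A
  have m0: "\<And>A. 0 \<le> m A"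
    using \<mu> by (auto simp: m_def V distribution_on_def)
  have mF: "\<And>A. A \<notin> ?F \<Longrightarrow> m A = 0"
    by (simp add: m_def)
  have m1: "(\<Sum>A\<in>UNIV. m A) = 1"
    using \<mu> by (subst sumF [symmetric]) (simp_all add: m_def distribution_on_def sumV)
  have mh: "h = (\<Sum>A\<in>UNIV. m A *\<^sub>R indicator_vec A)"
    by (subst sumF [symmetric]) (simp_all add: m_def h_def sumV)
  obtain \<kappa> where \<kappa>: "\<And>p. 0 \<le> \<kappa> $ p" "\<And>A B. B \<notin> ?F \<Longrightarrow> \<kappa> $ (A, B) = 0"
      "\<And>A. plan_row \<kappa> A = m A" "plan_mean \<kappa> = h'" "plan_cost \<kappa> \<le> ?N * l1norm (h - h')"
    by (rule transport_plan_exists [OF M m0 mF m1 mh h']) blast+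
  \<comment> \<open>A row outside the bases has sum 0 and nonnegative entries, so the plan lives on
    pairs of bases.\<close>
  have "\<kappa> $ (A, B) = 0" if "A \<notin> ?F" for A B
    using \<kappa>(1) \<kappa>(3) [of A] that sum_nonneg_0 [of UNIV "\<lambda>B. \<kappa> $ (A, B)" B]
    by (simp add: plan_row_def m_def)
  with \<kappa>(2) have \<kappa>0: "\<kappa> $ p = 0" if "p \<notin> ?F \<times> ?F" for p
    using that by (cases p) auto
  have sumFF: "(\<Sum>A\<in>?F. \<Sum>B\<in>?F. g (A, B)) = (\<Sum>p\<in>UNIV. g p)"
    if "\<And>p. \<kappa> $ p = 0 \<Longrightarrow> g p = 0" for g :: "'e set \<times> 'e set \<Rightarrow> 'b::comm_monoid_add"
    unfolding sum.cartesian_product' [symmetric]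
    using that \<kappa>0 by (intro sum.mono_neutral_left) auto
  \<comment> \<open>A left inverse of \<open>indicator_vec\<close>, used to read the plan as a
    function of vectors.\<close>
  define supp where "supp v = {i. v $ i = 1}" for v :: "real ^ 'e"
  have supp: "supp (indicator_vec A) = A" for A
    by (auto simp: supp_def indicator_vec_nth)
  define k where "k v v' = \<kappa> $ (supp v, supp v')" for v v'
  define \<mu>' where "\<mu>' v' = (\<Sum>v\<in>?V. k v v')" for v'
  have "sum \<mu>' ?V = (\<Sum>v\<in>?V. \<Sum>v'\<in>?V. k v v')"
    unfolding \<mu>'_def by (rule sum.swap)
  also have "\<dots> = (\<Sum>A\<in>?F. \<Sum>B\<in>?F. \<kappa> $ (A, B))"
    by (simp add: sumV k_def supp)
  also have "\<dots> = (\<Sum>p\<in>UNIV. \<kappa> $ p)"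
    by (rule sumFF)
  also have "\<dots> = 1"
    using m1 \<kappa>(3) by (simp add: sum_plan_row [symmetric])
  finally have "distribution_on ?V \<mu>'"
    using \<kappa>(1) by (auto simp: distribution_on_def \<mu>'_def k_def intro!: sum_nonneg)
  moreover have "(\<Sum>v\<in>?V. \<mu>' v *\<^sub>R v) = h'"
  proof -
    have "(\<Sum>v\<in>?V. \<mu>' v *\<^sub>R v) = (\<Sum>B\<in>?F. \<Sum>A\<in>?F. \<kappa> $ (A, B) *\<^sub>R indicator_vec B)"
      by (simp add: \<mu>'_def sumV k_def supp scaleR_sum_left)
    also have "\<dots> = (\<Sum>A\<in>?F. \<Sum>B\<in>?F. \<kappa> $ (A, B) *\<^sub>R indicator_vec B)"
      by (rule sum.swap)
    also have "\<dots> = plan_mean \<kappa>"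
      using sumFF [of "\<lambda>p. \<kappa> $ p *\<^sub>R indicator_vec (snd p)"] by (simp add: plan_mean_def)
    finally show ?thesis using \<kappa>(4) by simp
  qed
  moreover have "coupling_on ?V \<mu> \<mu>' k"
  proof -
    have "(\<Sum>v'\<in>?V. k (indicator_vec A) v') = \<mu> (indicator_vec A)" if "A \<in> ?F" for A
    proof -
      have "(\<Sum>v'\<in>?V. k (indicator_vec A) v') = (\<Sum>B\<in>?F. \<kappa> $ (A, B))"
        by (simp add: sumV k_def supp)
      also have "\<dots> = plan_row \<kappa> A"
        unfolding plan_row_def by (rule sumF) (rule \<kappa>(2))
      finally show ?thesis using \<kappa>(3) that by (simp add: m_def)
    qed
    then show ?thesis
      using \<kappa>(1) by (simp add: coupling_on_def k_def \<mu>'_def V)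
  qed
  ultimately have "OAT_tilde (basis_polytope indep) h' \<mu>
      \<le> ennreal (\<Sum>v\<in>?V. \<Sum>v'\<in>?V. k v v' * l1norm (v - v'))"
    unfolding OAT_tilde_def by (intro Inf_lower) blast
  also have "(\<Sum>v\<in>?V. \<Sum>v'\<in>?V. k v v' * l1norm (v - v')) = plan_cost \<kappa>"
    using sumFF [of "\<lambda>p. \<kappa> $ p * l1norm (indicator_vec (fst p) - indicator_vec (snd p))"]
    by (simp add: plan_cost_def sumV k_def supp)
  also have "ennreal (plan_cost \<kappa>) \<le> ennreal (?N * l1norm (h - h'))"
    using \<kappa>(5) by (rule ennreal_leI)
  finally have "OAT_tilde (basis_polytope indep) h' \<mu> / ennreal (l1norm (h - h'))
      \<le> ennreal (?N * l1norm (h - h')) / ennreal (l1norm (h - h'))"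
    by (rule divide_right_mono_ennreal)
  \<comment> \<open>The divisor is positive, and \<open>?N\<close> is nonnegative because a type is
    nonempty.\<close>
  also have "\<dots> = ennreal ?N"
    using l by (subst divide_ennreal) (simp_all add: Suc_le_eq)
  finally show "OAT_tilde (basis_polytope indep) h' \<mu>
      / ennreal (l1norm ((\<Sum>v\<in>?V. \<mu> v *\<^sub>R v) - h')) \<le> ennreal ?N"
    by (simp add: h_def)
qed

theorem theorem5p10:
  fixes indep :: "'e::finite set \<Rightarrow> bool"
  assumes "matroid (UNIV :: 'e set) indep"
  shows "Lip_scaled (real (matroid_rank indep)) (basis_polytope indep)
           \<le> Lip_tilde (basis_polytope indep)
       \<and> Lip_tilde (basis_polytope indep) \<le> ennreal (real CARD('e) - 1)"
proof
  have "polytope (basis_polytope indep)"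
    unfolding basis_polytope_def by (intro polytope_convex_hull) simp
  then show "Lip_scaled (real (matroid_rank indep)) (basis_polytope indep)
      \<le> Lip_tilde (basis_polytope indep)"
    \<comment> \<open>On nonnegative vectors the norm is the coordinate sum, here the rank, so the
      rank is the scale \<open>c\<close>.\<close>
    using sum_basis_polytope [OF assms]
    by (intro Lip_scaled_le_Lip_tilde) (auto simp: l1norm_nonneg_vec)
  show "Lip_tilde (basis_polytope indep) \<le> ennreal (real CARD('e) - 1)"
    by (rule Lip_tilde_basis_polytope_le [OF assms])
qed

end
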